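(* Let $m\le n$ be positive integers and let $\mathsf{A}\in\mathbb{R}^{m\times n}$ with $\mathrm{rank}(\mathsf{A})=m$. Consider the linear mapping $\boldsymbol{Y}=\mathsf{A}\boldsymbol{X}$, where $\boldsymbol{X}\in\mathbb{R}^n$ and $\boldsymbol{Y}\in\mathbb{R}^m$ are Gaussian random vectors. Given a message $\mu_{\boldsymbol{Y}}(\mathbf{y})=f^{\mathrm E}(\mathbf{y};\mathbf{u}_{\boldsymbol{Y}},\mathsf{V}_{\boldsymbol{Y}})$ of $\boldsymbol{Y}$, with $\mathbf{u}_{\boldsymbol{Y}}\in\mathbb{R}^m$ and $\mathsf{V}_{\boldsymbol{Y}}\in\mathbb{R}^{m\times m}$ symmetric positive definite, the inferred message of $\boldsymbol{X}$, defined by $\mu_{\boldsymbol{X}}(\mathbf{x})=\int\delta(\mathbf{y}-\mathsf{A}\mathbf{x})\,\mu_{\boldsymbol{Y}}(\mathbf{y})\,\mathrm{d}\mathbf{y}=f^{\mathrm E}(\mathsf{A}\mathbf{x};\mathbf{u}_{\boldsymbol{Y}},\mathsf{V}_{\boldsymbol{Y}})$, satisfies for all $\mathbf{x}\in\mathbb{R}^n$ $$\mu_{\boldsymbol{X}}(\mathbf{x})=s\cdot f^{\mathrm E}(\mathbf{x};\mathbf{u}_{\boldsymbol{X}},\mathsf{V}_{\boldsymbol{X}}),$$ where $$\mathbf{u}_{\boldsymbol{X}}=\mathsf{A}^{\mathrm T}\mathbf{u}_{\boldsymbol{Y}},\qquad \mathsf{V}_{\boldsymbol{X}}=\mathsf{A}^{\mathrm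 T}\mathsf{V}_{\boldsymbol{Y}}\mathsf{A},\qquad s=\left(\frac{|\mathsf{V}_{\boldsymbol{Y}}|}{|\mathsf{V}_{\boldsymbol{X}}|_+}\right)^{1/2}.$$
   Context: For a symmetric positive semidefinite matrix $\mathsf{V}\in\mathbb{R}^{d\times d}$ of rank $k$ and a vector $\mathbf{u}\in\mathbb{R}^d$ of the form $\mathbf{u}=\mathsf{V}\mathbf{m}$ for some $\mathbf m\in\mathbb{R}^d$, the (possibly degenerate) Gaussian density in the parameters $(\mathbf{u},\mathsf{V})$ is the function on all of $\mathbb{R}^d$ $$f^{\mathrm E}(\mathbf{x};\mathbf{u},\mathsf{V})=\frac{|\mathsf{V}|_+^{1/2}}{(2\pi)^{k/2}}\exp\!\Big(-\tfrac12\mathbf{x}^{\mathrm T}\mathsf{V}\mathbf{x}+\mathbf{x}^{\mathrm T}\mathbf{u}-\tfrac12\mathbf{u}^{\mathrm T}\mathsf{V}^{+}\mathbf{u}\Big).$$ Here $\mathsf{V}^+$ is the Moore–Penrose pseudo-inverse and $|\mathsf{V}|_+$ is the pseudo-determinant, i.e. the product of the positive eigenvalues of $\mathsf{V}$ counted with multiplicity; $|\cdot|$ is the ordinary determinant. (It corresponds to the Gaussian with covariance $\mathsf\Sigma=\mathsf V^+$, mean $\mathbf m$.) $\delta$ is the Dirac delta, so the integral is by definition evaluation of $\mu_{\boldsymbol Y}$ at $\mathsf{A}\mathbf{x}$. *)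

theory Defs
  imports "HOL-Probability.Probability" "HOL-Computational_Algebra.Polynomial"
begin

definition positive_semidefinite :: "real^'d^'d \<Rightarrow> bool" where
  "positive_semidefinite V \<longleftrightarrow> transpose V = V \<and> (\<forall>x. 0 \<le> x \<bullet> (V *v x))"

definition positive_definite :: "real^'d^'d \<Rightarrow> bool" where
  "positive_definite V \<longleftrightarrow> transpose V = V \<and> (\<forall>x. x \<noteq> 0 \<longrightarrow> 0 < x \<bullet> (V *v x))"

text \<open>The four Penrose conditions determine the pseudo-inverse uniquely.\<close>

definition is_pseudo_inverse :: "real^'n^'m \<Rightarrow> real^'m^'n \<Rightarrow> bool" where
  "is_pseudo_inverse M P \<longleftrightarrow>
     M ** P ** M = M \<and> P ** M ** P = P \<and>
     transpose (M ** P) = M ** P \<and> transpose (P ** M) = P ** M"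

definition pseudo_inverse :: "real^'n^'m \<Rightarrow> real^'m^'n" where
  "pseudo_inverse M = (THE P. is_pseudo_inverse M P)"

definition eigenvalues :: "real^'d^'d \<Rightarrow> real set" where
  "eigenvalues V = {c. \<exists>x. x \<noteq> 0 \<and> V *v x = c *\<^sub>R x}"

text \<open>The determinant of \<open>tI - V\<close>, computed over the ring of real polynomials in \<open>t\<close>.\<close>

definition characteristic_poly :: "real^'d^'d \<Rightarrow> real poly" where
  "characteristic_poly V = det (\<chi> i j. (if i = j then [:0, 1:] else 0) - [:V $ i $ j:])"

text \<open>Eigenvalues are counted with algebraic multiplicity (which, for the symmetric matrices
  considered here, is also the geometric one); the empty product is \<open>1\<close>.\<close>

definition pseudo_det :: "real^'d^'d \<Rightarrow> real" where
  "pseudo_det V = (\<Prod>c\<in>{c \<in> eigenvalues V. 0 < c}. c ^ order c (characteristic_poly V))"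

definition gaussian_parameters :: "real^'d \<Rightarrow> real^'d^'d \<Rightarrow> bool" where
  "gaussian_parameters u V \<longleftrightarrow> positive_semidefinite V \<and> (\<exists>m. u = V *v m)"

text \<open>Meaningful only when \<open>gaussian_parameters u V\<close> holds. For singular \<open>V\<close> this is still a
  function on the whole space, and not a normalised density.\<close>

definition gaussian_density :: "real^'d \<Rightarrow> real^'d \<Rightarrow> real^'d^'d \<Rightarrow> real" where
  "gaussian_density x u V =
     sqrt (pseudo_det V) / (2 * pi) powr (real (rank V) / 2) *
     exp (- (1/2) * (x \<bullet> (V *v x)) + x \<bullet> u - (1/2) * (u \<bullet> (pseudo_inverse V *v u)))"

text \<open>The message \<open>\<integral> \<delta>(y - A x) \<mu>(y) dy\<close>: the factor \<open>\<delta>(y - A x) dy\<close> is the Dirac measure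
  at \<open>A x\<close>, written \<open>return borel (A *v x)\<close>.\<close>

definition inferred_message :: "real^'n^'m \<Rightarrow> (real^'m \<Rightarrow> real) \<Rightarrow> real^'n \<Rightarrow> real" where
  "inferred_message A \<mu> x = (\<integral>y. \<mu> y \<partial>return borel (A *v x))"

end

theory Submission
  imports Defs "HOL-Computational_Algebra.Fundamental_Theorem_Algebra"
begin

text \<open>
  Up to normalisation, both sides are the exponential of the same quadratic form. For its constant
  term, a right inverse \<open>B\<close> of \<open>A\<close> with \<open>B A\<close> symmetric gives
  \<open>V\<^sub>X\<^sup>+ = B V\<^sub>Y\<^sup>-\<^sup>1 B\<^sup>T\<close>, and \<open>B\<^sup>T u\<^sub>X = u\<^sub>Y\<close>. The ranks of \<open>V\<^sub>X\<close> and \<open>V\<^sub>Y\<close> agree, so the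
  prefactors differ by \<open>s\<close> once \<open>|V\<^sub>Y|\<^sub>+ = |V\<^sub>Y|\<close> is known. The latter holds because the
  characteristic polynomial of a symmetric matrix splits over the reals: it has only real roots in
  the complex plane.
\<close>

section \<open>Real-rooted polynomials\<close>

lemma map_poly_of_real_mult:
  "map_poly complex_of_real (p * q) = map_poly of_real p * map_poly of_real q"
  by (intro poly_eqI) (simp add: coeff_map_poly coeff_mult)

text \<open>Induction splits off one root at a time with its full multiplicity. What remains without
  real roots has, by the hypothesis, no complex root either, so it is constant by the fundamental
  theorem of algebra.\<close>

lemma real_rooted_poly_eq_prod_linear_factors:
  fixes p :: "real poly"
  assumes "p \<noteq> 0" "\<And>z::complex. poly (map_poly of_real p) z = 0 \<Longrightarrow> z \<in> \<real>"
  shows "p = smult (lead_coeff p) (\<Prod>c\<in>{c. poly p c = 0}. [:-c, 1:] ^ order c p)"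
  using assms
proof (induction p rule: poly_root_order_induct)
  case (no_roots p)
  have no_complex_root: "poly (map_poly complex_of_real p) z \<noteq> 0" for z
  proof
    assume z: "poly (map_poly complex_of_real p) z = 0"
    then obtain x where "z = of_real x"
      using no_roots(3) by (auto elim: Reals_cases)
    moreover have "poly (map_poly complex_of_real p) (of_real x) = of_real (poly p x)"
      by (induction p) (auto simp: map_poly_pCons)
    ultimately show False
      using z no_roots(1)[of x] by simp
  qed
  have "constant (poly (map_poly complex_of_real p))"
    using fundamental_theorem_of_algebra no_complex_root by blast
  then have "degree (map_poly complex_of_real p) = 0"
    by (simp add: constant_degree)
  then have "degree p = 0"
    by (simp add: degree_map_poly)
  then show ?case
    using no_roots(1) by (auto elim: degree_eq_zeroE)
next
  case (root p x n)
  let ?q = "[:-x, 1:] ^ n * p"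
  have p: "p \<noteq> 0" using root by auto
  have "p = smult (lead_coeff p) (\<Prod>c\<in>{c. poly p c = 0}. [:-c, 1:] ^ order c p)"
    using root p by (intro root.IH) (auto simp: map_poly_of_real_mult)
  \<comment> \<open>Since \<open>x\<close> is not a root of the cofactor \<open>p\<close>, the new
    factor contributes exactly one new root, of order \<open>n\<close>, and leaves all other orders
    unchanged.\<close>
  moreover have "{c. poly ?q c = 0} = insert x {c. poly p c = 0}"
    using root(1) by auto
  moreover have "order x ?q = n"
    using p root by (simp add: order_mult order_power_n_n order_0I)
  moreover have "order c ?q = order c p" if "c \<noteq> x" for c
    using p that by (simp add: order_mult order_0I)
  then have "(\<Prod>c\<in>{c. poly p c = 0}. [:-c, 1:] ^ order c ?q) =
      (\<Prod>c\<in>{c. poly p c = 0}. [:-c, 1:] ^ order c p)"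
    using root(2) by (intro prod.cong refl) (metis mem_Collect_eq)
  moreover have "lead_coeff ?q = lead_coeff p"
    by (simp add: lead_coeff_mult lead_coeff_power)
  ultimately show ?case
    using root(2) p by (simp add: poly_roots_finite mult_smult_right[symmetric] del: mult_smult_right)
qed simp

text \<open>Meant for the summands of the Leibniz formula. Factors may be constant, so the
  coefficient is taken at position \<open>card S\<close> rather than at the actual degree.\<close>

lemma degree_coeff_prod_linear:
  fixes f :: "'a \<Rightarrow> 'b::comm_ring_1 poly"
  assumes "finite S" "\<And>i. i \<in> S \<Longrightarrow> degree (f i) \<le> 1"
  shows "degree (prod f S) \<le> card S \<and> coeff (prod f S) (card S) = (\<Prod>i\<in>S. coeff (f i) 1)"
  using assms
proof (induction S)
  case (insert i S)
  then have deg_i: "degree (f i) \<le> 1" and deg_S: "degree (prod f S) \<le> card S"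
    by auto
  have linear: "f i = [:coeff (f i) 0, coeff (f i) 1:]"
  proof (rule poly_eqI)
    fix k
    show "coeff (f i) k = coeff [:coeff (f i) 0, coeff (f i) 1:] k"
      using deg_i by (cases "k \<le> 1") (auto simp: coeff_pCons coeff_eq_0 split: nat.split)
  qed
  have "coeff (prod f S) (Suc (card S)) = 0"
    using deg_S by (simp add: coeff_eq_0)
  then have "coeff (f i * prod f S) (Suc (card S)) = coeff (f i) 1 * coeff (prod f S) (card S)"
    by (subst linear) (simp add: mult_pCons_left)
  moreover have "degree (f i * prod f S) \<le> Suc (card S)"
    using degree_mult_le[of "f i" "prod f S"] deg_i deg_S by linarith
  ultimately show ?case
    using insert by simp
qed simp

section \<open>The characteristic polynomial\<close>

text \<open>The determinant is an integer polynomial in the entries. The maps of interest evaluate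
  polynomial entries at a real or complex point.\<close>

lemma det_hom:
  fixes h :: "'a::comm_ring_1 \<Rightarrow> 'b::comm_ring_1" and M :: "'a^'n^'n"
  assumes add: "\<And>x y. h (x + y) = h x + h y" and mult: "\<And>x y. h (x * y) = h x * h y"
    and one: "h 1 = 1"
  shows "h (det M) = det (\<chi> i j. h (M $ i $ j))"
proof -
  have zero: "h 0 = 0"
    using add[of 0 0] by simp
  have minus: "h (- x) = - h x" for x
    using add[of x "- x"] zero by (simp add: eq_neg_iff_add_eq_0 add.commute)
  have sum: "h (sum f S) = (\<Sum>i\<in>S. h (f i))" for f :: "('n \<Rightarrow> 'n) \<Rightarrow> 'a" and S
    by (induction S rule: infinite_finite_induct) (auto simp: add zero)
  have prod: "h (prod f S) = (\<Prod>i\<in>S. h (f i))" for f :: "'n \<Rightarrow> 'a" and S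
    by (induction S rule: infinite_finite_induct) (auto simp: mult one)
  show ?thesis
    by (simp add: det_def sum mult prod) (auto intro!: sum.cong simp: sign_def one minus)
qed

lemma characteristic_poly_monic:
  fixes V :: "real^'d^'d"
  shows "lead_coeff (characteristic_poly V) = 1"
    and "degree (characteristic_poly V) = CARD('d)"
proof -
  define M :: "real poly^'d^'d" where
    "M = (\<chi> i j. (if i = j then [:0, 1:] else 0) - [:V $ i $ j:])"
  have M: "characteristic_poly V = det M"
    by (simp add: characteristic_poly_def M_def)
  have deg_entry: "degree (M $ i $ j) \<le> 1" for i j
    by (simp add: M_def)
  have prod: "degree (\<Prod>i\<in>UNIV. M $ i $ \<sigma> i) \<le> CARD('d)"
    "coeff (\<Prod>i\<in>UNIV. M $ i $ \<sigma> i) CARD('d) = (\<Prod>i\<in>UNIV. coeff (M $ i $ \<sigma> i) 1)" for \<sigma>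
    using degree_coeff_prod_linear[of UNIV "\<lambda>i. M $ i $ \<sigma> i"] deg_entry by auto
  have sign: "of_int (sign \<sigma>) * q = smult (of_int (sign \<sigma>)) q" for \<sigma> :: "'d \<Rightarrow> 'd" and q :: "real poly"
    by (simp add: sign_def)
  \<comment> \<open>The linear coefficients of the entries of \<open>M\<close> form the identity
    matrix, so the Leibniz sum of the top coefficients is its determinant.\<close>
  have "coeff (det M) CARD('d) = det (mat 1 :: real^'d^'d)"
    unfolding det_def
    by (simp add: coeff_sum sign prod)
      (auto intro!: sum.cong prod.cong simp: M_def mat_def)
  then have coeff: "coeff (characteristic_poly V) CARD('d) = 1"
    by (simp add: M)
  have "degree (det M) \<le> CARD('d)"
    unfolding det_def sign
    by (intro degree_sum_le order_trans[OF degree_smult_le] prod) (simp add: finite_permutations)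
  then show "degree (characteristic_poly V) = CARD('d)"
    using coeff le_degree[of "characteristic_poly V" "CARD('d)"] by (simp add: M)
  then show "lead_coeff (characteristic_poly V) = 1"
    using coeff by simp
qed

lemma poly_characteristic_poly:
  "poly (characteristic_poly V) c = det (c *\<^sub>R mat 1 - V)"
  unfolding characteristic_poly_def
  by (subst det_hom[where h = "\<lambda>q. poly q c"])
    (auto intro!: arg_cong[where f = det] simp: vec_eq_iff mat_def)

lemma poly_map_poly_characteristic_poly:
  "poly (map_poly of_real (characteristic_poly V)) (z::complex) =
    det (\<chi> i j. (if i = j then z else 0) - of_real (V $ i $ j))"
proof -
  have "map_poly complex_of_real (r + s) = map_poly of_real r + map_poly of_real s" for r s
    by (intro poly_eqI) (simp add: coeff_map_poly)
  then show ?thesis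
    unfolding characteristic_poly_def
    by (subst det_hom[where h = "\<lambda>q. poly (map_poly of_real q) z"])
      (auto intro!: arg_cong[where f = det] simp: vec_eq_iff map_poly_pCons map_poly_of_real_mult)
qed

text \<open>Stated over any field because complex eigenvectors are needed as well as real
  ones.\<close>

lemma det_eq_0_imp_kernel:
  fixes M :: "'a::field^'n^'n"
  assumes "det M = 0"
  obtains x where "x \<noteq> 0" "M *v x = 0"
  using assms invertible_det_nz[of M] invertible_left_inverse[of M] matrix_left_invertible_ker[of M]
  by blast

lemma det_nonzeroI:
  fixes M :: "'a::field^'n^'n"
  assumes "\<And>x. M *v x = 0 \<Longrightarrow> x = 0"
  shows "det M \<noteq> 0"
  using assms det_eq_0_imp_kernel by metis

lemma eigenvalues_eq_roots:
  fixes V :: "real^'d^'d"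
  shows "eigenvalues V = {c. poly (characteristic_poly V) c = 0}"
proof -
  have eig: "V *v x = c *\<^sub>R x \<longleftrightarrow> (c *\<^sub>R mat 1 - V) *v x = 0" for c x
    by (auto simp: matrix_vector_mult_diff_rdistrib scaleR_matrix_vector_assoc[symmetric])
  show ?thesis
    unfolding eigenvalues_def eig poly_characteristic_poly
    using det_eq_0_imp_kernel det_nonzeroI
    by (metis (no_types, lifting) invertible_det_nz invertible_left_inverse matrix_left_invertible_ker)
qed

lemma inner_matrix_vector_mult_right:
  fixes M :: "real^'n^'m"
  shows "x \<bullet> (M *v y) = (transpose M *v x) \<bullet> y"
  by (simp add: dot_lmul_matrix)

text \<open>Write a complex eigenvector as \<open>a + i b\<close> with real \<open>a\<close> and
  \<open>b\<close>. Symmetry equates \<open>a \<bullet> (V *v b)\<close> with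
  \<open>b \<bullet> (V *v a)\<close>, and the difference of the two is \<open>Im z\<close> times
  the squared norm of the eigenvector.\<close>

lemma symmetric_characteristic_poly_real_rooted:
  fixes V :: "real^'d^'d"
  assumes "transpose V = V" "poly (map_poly complex_of_real (characteristic_poly V)) z = 0"
  shows "z \<in> \<real>"
proof -
  define M :: "complex^'d^'d" where "M = (\<chi> i j. (if i = j then z else 0) - of_real (V $ i $ j))"
  obtain x where x: "x \<noteq> 0" "M *v x = 0"
    using assms(2) det_eq_0_imp_kernel[of M] by (auto simp: poly_map_poly_characteristic_poly M_def)
  define a where "a = (\<chi> i. Re (x $ i))"
  define b where "b = (\<chi> i. Im (x $ i))"
  have eig: "(\<Sum>j\<in>UNIV. of_real (V $ i $ j) * x $ j) = z * x $ i" for i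
  proof -
    have "(M *v x) $ i = z * x $ i - (\<Sum>j\<in>UNIV. of_real (V $ i $ j) * x $ j)"
      by (simp add: M_def matrix_vector_mult_def left_diff_distrib sum_subtractf if_distrib
          [where f = "\<lambda>t. t * _"] cong: if_cong)
    then show ?thesis using x by simp
  qed
  have Va: "V *v a = Re z *\<^sub>R a - Im z *\<^sub>R b"
    using arg_cong[OF eig, of Re] by (simp add: vec_eq_iff matrix_vector_mult_def a_def b_def)
  have Vb: "V *v b = Re z *\<^sub>R b + Im z *\<^sub>R a"
    using arg_cong[OF eig, of Im] by (simp add: vec_eq_iff matrix_vector_mult_def a_def b_def)
  have "a \<bullet> (V *v b) = b \<bullet> (V *v a)"
    using inner_matrix_vector_mult_right[of a V b] assms(1) by (simp add: inner_commute)
  then have "Im z * (a \<bullet> a + b \<bullet> b) = 0"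
    by (simp add: Va Vb algebra_simps inner_commute)
  moreover have "a \<noteq> 0 \<or> b \<noteq> 0"
    using x(1) by (auto simp: a_def b_def vec_eq_iff complex_eq_iff)
  then have "a \<bullet> a + b \<bullet> b \<noteq> 0"
    by (metis add_nonneg_eq_0_iff inner_eq_zero_iff inner_ge_zero)
  ultimately show ?thesis
    by (simp add: complex_is_Real_iff)
qed

section \<open>The pseudo-determinant and the pseudo-inverse\<close>

lemma pseudo_det_pos: "0 < pseudo_det V"
  unfolding pseudo_det_def by (intro prod_pos) auto

lemma positive_definite_det_nonzero: "positive_definite V \<Longrightarrow> det V \<noteq> 0"
  by (rule det_nonzeroI) (metis inner_zero_right less_irrefl positive_definite_def)

text \<open>Evaluate the factored characteristic polynomial at 0, which gives
  \<open>det (- V)\<close>.\<close>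

lemma det_symmetric_eq_prod_eigenvalues:
  fixes V :: "real^'d^'d"
  assumes "transpose V = V"
  shows "det V = (\<Prod>c\<in>eigenvalues V. c ^ order c (characteristic_poly V))"
proof -
  let ?p = "characteristic_poly V"
  have "?p \<noteq> 0"
    using characteristic_poly_monic(1)[of V] by auto
  then have factored: "?p = (\<Prod>c\<in>eigenvalues V. [:-c, 1:] ^ order c ?p)"
    using real_rooted_poly_eq_prod_linear_factors[of ?p] characteristic_poly_monic(1)[of V]
      symmetric_characteristic_poly_real_rooted[OF assms]
    by (simp add: eigenvalues_eq_roots)
  \<comment> \<open>Comparing degrees shows that the multiplicities add up to the dimension, so the
    signs of the factors \<open>- c\<close> combine to the sign relating \<open>det (- V)\<close> to
    \<open>det V\<close>.\<close>
  have "degree (\<Prod>c\<in>eigenvalues V. [:-c, 1:] ^ order c ?p) = (\<Sum>c\<in>eigenvalues V. order c ?p)"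
    by (subst degree_prod_sum_eq) (auto simp: degree_linear_power)
  then have multiplicities: "(\<Sum>c\<in>eigenvalues V. order c ?p) = CARD('d)"
    using factored characteristic_poly_monic(2)[of V] by simp
  have "det (- V) = poly (\<Prod>c\<in>eigenvalues V. [:-c, 1:] ^ order c ?p) 0"
    using factored poly_characteristic_poly[of V 0] by simp
  also have "\<dots> = (\<Prod>c\<in>eigenvalues V. (- 1) ^ order c ?p * c ^ order c ?p)"
    by (simp add: poly_prod flip: power_mult_distrib)
  also have "\<dots> = (- 1) ^ CARD('d) * (\<Prod>c\<in>eigenvalues V. c ^ order c ?p)"
    by (simp add: prod.distrib multiplicities flip: power_sum)
  finally have "det (- V) = (- 1) ^ CARD('d) * (\<Prod>c\<in>eigenvalues V. c ^ order c ?p)" .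
  moreover have "(\<chi> i. - 1 *s V $ i) = - V"
    by (simp add: vec_eq_iff)
  then have "det (- V) = (- 1) ^ CARD('d) * det V"
    using det_rows_mul[of "\<lambda>_. - 1" "\<lambda>i. V $ i"] by simp
  ultimately show ?thesis
    by simp
qed

text \<open>Pairing \<open>V *v x = c *\<^sub>R x\<close> with \<open>x\<close> forces
  \<open>c\<close> to be positive, so restricting the product to positive eigenvalues discards
  nothing.\<close>

lemma positive_definite_pseudo_det:
  fixes V :: "real^'d^'d"
  assumes "positive_definite V"
  shows "pseudo_det V = det V"
proof -
  have "0 < c" if c: "c \<in> eigenvalues V" for c
  proof -
    obtain x where x: "x \<noteq> 0" "V *v x = c *\<^sub>R x"
      using c by (auto simp: eigenvalues_def)
    then have "0 < c * (x \<bullet> x)"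
      using assms by (metis inner_scaleR_right positive_definite_def)
    then show ?thesis
      using inner_ge_zero[of x] by (auto simp: zero_less_mult_iff)
  qed
  then have "{c \<in> eigenvalues V. 0 < c} = eigenvalues V"
    by auto
  then show ?thesis
    using assms by (simp add: pseudo_det_def det_symmetric_eq_prod_eigenvalues positive_definite_def)
qed

text \<open>Needed because \<open>pseudo_inverse\<close> is a definite description. The products
  \<open>M ** P\<close> and \<open>P ** M\<close> are symmetric projections already determined by
  \<open>M\<close>.\<close>

lemma is_pseudo_inverse_unique:
  assumes P: "is_pseudo_inverse M P" and Q: "is_pseudo_inverse M Q"
  shows "P = Q"
proof -
  have "M ** P = transpose ((M ** Q) ** (M ** P))"
    using P Q by (metis is_pseudo_inverse_def matrix_mul_assoc)
  also have "\<dots> = (M ** P) ** (M ** Q)"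
    using P Q by (simp add: is_pseudo_inverse_def matrix_transpose_mul)
  also have "\<dots> = M ** Q"
    using P by (metis is_pseudo_inverse_def matrix_mul_assoc)
  finally have MP: "M ** P = M ** Q" .
  have "P ** M = transpose ((P ** M) ** (Q ** M))"
    using P Q by (metis is_pseudo_inverse_def matrix_mul_assoc)
  also have "\<dots> = (Q ** M) ** (P ** M)"
    using P Q by (simp add: is_pseudo_inverse_def matrix_transpose_mul)
  also have "\<dots> = Q ** M"
    using P by (metis is_pseudo_inverse_def matrix_mul_assoc)
  finally have PM: "P ** M = Q ** M" .
  \<comment> \<open>The chain is
    \<open>P = (P ** M) ** P = Q ** (M ** P) = Q ** M ** Q = Q\<close>.\<close>
  show "P = Q"
    using P Q MP PM by (metis is_pseudo_inverse_def matrix_mul_assoc)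
qed

lemma pseudo_inverse_eqI:
  assumes "is_pseudo_inverse M P"
  shows "pseudo_inverse M = P"
  unfolding pseudo_inverse_def using assms is_pseudo_inverse_unique by blast

lemma pseudo_inverse_invertible:
  fixes V :: "real^'d^'d"
  assumes "V ** W = mat 1" "W ** V = mat 1"
  shows "pseudo_inverse V = W"
  using assms by (intro pseudo_inverse_eqI) (simp add: is_pseudo_inverse_def)

section \<open>Congruence by a matrix of full row rank\<close>

lemma full_row_rank_pseudo_inverse:
  fixes A :: "real^'n^'m"
  assumes "rank A = CARD('m)"
  obtains B where "A ** B = mat 1" "transpose (B ** A) = B ** A"
proof -
  have inj: "inj ((*v) (transpose A))"
    using assms rank_transpose[of A] full_rank_injective[of "transpose A"] by simp
  \<comment> \<open>The quadratic form of \<open>A ** transpose A\<close> at \<open>y\<close> is the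
    squared norm of \<open>transpose A *v y\<close>, and \<open>transpose A\<close> is
    injective.\<close>
  have "det (A ** transpose A) \<noteq> 0"
  proof (rule det_nonzeroI)
    fix y :: "real^'m"
    assume "(A ** transpose A) *v y = 0"
    then have "y \<bullet> (A *v (transpose A *v y)) = 0"
      by (simp only: matrix_vector_mul_assoc inner_zero_right)
    then have "transpose A *v y = 0"
      using inner_matrix_vector_mult_right[of y A "transpose A *v y"] by (metis inner_eq_zero_iff)
    then show "y = 0"
      using inj by (metis injD matrix_vector_mult_0_right)
  qed
  then obtain G where G: "(A ** transpose A) ** G = mat 1"
    by (metis invertible_det_nz invertible_def)
  have "transpose ((A ** transpose A) ** G) = mat 1"
    by (simp only: G transpose_mat)
  then have "transpose G ** (A ** transpose A) = mat 1"
    by (simp add: matrix_transpose_mul)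
  \<comment> \<open>A left inverse and a right inverse of the same matrix coincide. This symmetry
    makes \<open>B ** A\<close>, that is \<open>transpose A ** G ** A\<close>, symmetric for the
    witness below.\<close>
  then have "transpose G = G"
    using G by (metis matrix_mul_assoc matrix_mul_lid matrix_mul_rid)
  then show ?thesis
    using G by (intro that[of "transpose A ** G"]) (simp_all add: matrix_transpose_mul matrix_mul_assoc)
qed

text \<open>Both products of the two matrices collapse to \<open>B ** A\<close>, the orthogonal
  projection onto the row space of \<open>A\<close>. It is symmetric and fixes both matrices from
  the left, which gives all four Penrose conditions.\<close>

lemma pseudo_inverse_congruence:
  fixes A :: "real^'n^'m" and V W :: "real^'m^'m"
  assumes AB: "A ** B = mat 1" and BA: "transpose (B ** A) = B ** A"
    and VW: "V ** W = mat 1" "W ** V = mat 1"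
  shows "pseudo_inverse (transpose A ** V ** A) = B ** W ** transpose B"
proof (rule pseudo_inverse_eqI)
  have "transpose (A ** B) = mat 1"
    by (simp only: AB transpose_mat)
  then have BtAt: "transpose B ** transpose A = mat 1"
    by (simp only: matrix_transpose_mul)
  have "(transpose A ** V ** A) ** (B ** W ** transpose B)
      = transpose A ** (V ** ((A ** B) ** W)) ** transpose B"
    by (simp only: matrix_mul_assoc)
  also have "\<dots> = B ** A"
    using BA by (simp add: AB VW matrix_transpose_mul)
  finally have 1: "(transpose A ** V ** A) ** (B ** W ** transpose B) = B ** A" .
  have "(B ** W ** transpose B) ** (transpose A ** V ** A)
      = B ** (W ** ((transpose B ** transpose A) ** V)) ** A"
    by (simp only: matrix_mul_assoc)
  also have "\<dots> = B ** A"
    by (simp add: BtAt VW)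
  finally have 2: "(B ** W ** transpose B) ** (transpose A ** V ** A) = B ** A" .
  have 3: "(B ** A) ** (transpose A ** V ** A) = transpose A ** V ** A"
  proof -
    \<comment> \<open>Replacing \<open>B ** A\<close> by its transpose puts
      \<open>transpose B\<close> next to \<open>transpose A\<close>, where they cancel.\<close>
    have "(B ** A) ** (transpose A ** V ** A) = transpose (B ** A) ** (transpose A ** V ** A)"
      by (simp only: BA)
    also have "\<dots> = transpose A ** (transpose B ** transpose A) ** V ** A"
      by (simp only: matrix_transpose_mul matrix_mul_assoc)
    finally show ?thesis
      by (simp add: BtAt)
  qed
  have 4: "(B ** A) ** (B ** W ** transpose B) = B ** W ** transpose B"
    by (metis AB matrix_mul_assoc matrix_mul_rid)
  show "is_pseudo_inverse (transpose A ** V ** A) (B ** W ** transpose B)"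
    unfolding is_pseudo_inverse_def 1 2 3 4 using BA by simp
qed

text \<open>The factor \<open>A\<close> bounds the rank from above. From below, multiplying by
  \<open>W ** transpose B\<close> on the left and by \<open>B\<close> on the right recovers the
  identity of size \<open>CARD('m)\<close>.\<close>

lemma rank_congruence:
  fixes A :: "real^'n^'m" and V :: "real^'m^'m"
  assumes "A ** B = mat 1" "W ** V = mat 1"
  shows "rank (transpose A ** V ** A) = CARD('m)"
proof (rule antisym)
  show "rank (transpose A ** V ** A) \<le> CARD('m)"
    using rank_mul_le_right[of "transpose A ** V" A] rank_bound[of A] by simp
  have "transpose (A ** B) = mat 1"
    by (simp only: assms transpose_mat)
  then have "transpose B ** transpose A = mat 1"
    by (simp only: matrix_transpose_mul)
  then have "W ** (transpose B ** transpose A) ** V ** (A ** B) = mat 1"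
    by (simp add: assms)
  then have "(W ** transpose B) ** ((transpose A ** V ** A) ** B) = mat 1"
    by (simp only: matrix_mul_assoc)
  then have "CARD('m) = rank ((W ** transpose B) ** ((transpose A ** V ** A) ** B))"
    by (simp only: rank_I)
  also have "\<dots> \<le> rank (transpose A ** V ** A)"
    by (rule order_trans[OF rank_mul_le_right rank_mul_le_left])
  finally show "CARD('m) \<le> rank (transpose A ** V ** A)" .
qed

section \<open>The message and its Gaussian form\<close>

lemma inferred_message_gaussian:
  "inferred_message A (\<lambda>y. gaussian_density y u V) x = gaussian_density (A *v x) u V"
proof -
  \<comment> \<open>Integration against the Dirac measure is point evaluation for measurable
    integrands; continuity supplies measurability.\<close>
  have "continuous_on UNIV (\<lambda>y. gaussian_density y u V)"
    unfolding gaussian_density_def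
    by (intro continuous_intros matrix_vector_mult_linear_continuous_on)
  then have "(\<lambda>y. gaussian_density y u V) \<in> borel_measurable borel"
    by (rule borel_measurable_continuous_onI)
  then show ?thesis
    by (simp add: inferred_message_def integral_return)
qed

theorem lemma2:
  fixes A :: "real^'n^'m"
    and u\<^sub>Y :: "real^'m" and V\<^sub>Y :: "real^'m^'m"
    and u\<^sub>X :: "real^'n" and V\<^sub>X :: "real^'n^'n"
    and \<mu>\<^sub>Y :: "real^'m \<Rightarrow> real" and \<mu>\<^sub>X :: "real^'n \<Rightarrow> real" and s :: real
  assumes "CARD('m) \<le> CARD('n)"
    and "rank A = CARD('m)"
    and "positive_definite V\<^sub>Y"
    and "\<mu>\<^sub>Y = (\<lambda>y. gaussian_density y u\<^sub>Y V\<^sub>Y)"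
    and "\<mu>\<^sub>X = inferred_message A \<mu>\<^sub>Y"
    and "u\<^sub>X = transpose A *v u\<^sub>Y"
    and "V\<^sub>X = transpose A ** V\<^sub>Y ** A"
    and "s = sqrt (det V\<^sub>Y / pseudo_det V\<^sub>X)"
  shows "gaussian_parameters u\<^sub>X V\<^sub>X \<and>
    (\<forall>x. \<mu>\<^sub>X x = gaussian_density (A *v x) u\<^sub>Y V\<^sub>Y \<and>
         \<mu>\<^sub>X x = s * gaussian_density x u\<^sub>X V\<^sub>X)"
proof -
  note sym = \<open>positive_definite V\<^sub>Y\<close>[unfolded positive_definite_def, THEN conjunct1]
  obtain B where AB: "A ** B = mat 1" and BA: "transpose (B ** A) = B ** A"
    using full_row_rank_pseudo_inverse assms(2) by blast
  obtain W where VW: "V\<^sub>Y ** W = mat 1" "W ** V\<^sub>Y = mat 1"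
    using positive_definite_det_nonzero[OF assms(3)] by (metis invertible_det_nz invertible_def)
  have quadratic: "x \<bullet> (V\<^sub>X *v x) = (A *v x) \<bullet> (V\<^sub>Y *v (A *v x))" for x
    using inner_matrix_vector_mult_right[of x "transpose A" "V\<^sub>Y *v (A *v x)"]
    by (simp add: assms(7) matrix_vector_mul_assoc matrix_mul_assoc del: transpose_matrix_vector)
  have linear: "x \<bullet> u\<^sub>X = (A *v x) \<bullet> u\<^sub>Y" for x
    using inner_matrix_vector_mult_right[of x "transpose A" u\<^sub>Y]
    by (simp add: assms(6) del: transpose_matrix_vector)
  have "positive_semidefinite V\<^sub>X"
    unfolding positive_semidefinite_def
  proof (intro conjI allI)
    show "transpose V\<^sub>X = V\<^sub>X"
      by (simp add: assms(7) matrix_transpose_mul sym matrix_mul_assoc)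
    show "0 \<le> x \<bullet> (V\<^sub>X *v x)" for x
      \<comment> \<open>On the kernel of \<open>A\<close> the form vanishes; elsewhere it is
        positive.\<close>
      using assms(3) by (cases "A *v x = 0") (auto simp: quadratic positive_definite_def less_imp_le)
  qed
  \<comment> \<open>The witness lifts the mean \<open>W *v u\<^sub>Y\<close> of \<open>Y\<close>
    through the right inverse \<open>B\<close>.\<close>
  moreover have "u\<^sub>X = V\<^sub>X *v (B *v (W *v u\<^sub>Y))"
  proof -
    have "V\<^sub>X ** B ** W = transpose A ** (V\<^sub>Y ** ((A ** B) ** W))"
      by (simp only: assms(7) matrix_mul_assoc)
    then show ?thesis
      by (simp add: assms(6) matrix_vector_mul_assoc matrix_mul_assoc AB VW
          del: transpose_matrix_vector)
  qed
  ultimately have "gaussian_parameters u\<^sub>X V\<^sub>X"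
    unfolding gaussian_parameters_def by blast
  moreover have "\<mu>\<^sub>X x = gaussian_density (A *v x) u\<^sub>Y V\<^sub>Y" for x
    by (simp add: assms(4,5) inferred_message_gaussian)
  moreover have "gaussian_density (A *v x) u\<^sub>Y V\<^sub>Y = s * gaussian_density x u\<^sub>X V\<^sub>X" for x
  proof -
    \<comment> \<open>The rank of \<open>V\<^sub>Y\<close> is the case of congruence by the
      identity.\<close>
    have "rank V\<^sub>X = rank V\<^sub>Y"
      using rank_congruence[OF AB VW(2)] rank_congruence[of "mat 1" "mat 1" W V\<^sub>Y] VW(2)
      by (simp add: assms(7))
    moreover have "u\<^sub>X \<bullet> (pseudo_inverse V\<^sub>X *v u\<^sub>X) = u\<^sub>Y \<bullet> (pseudo_inverse V\<^sub>Y *v u\<^sub>Y)"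
    proof -
      have BtAt: "transpose B *v u\<^sub>X = u\<^sub>Y"
        by (metis AB assms(6) matrix_transpose_mul matrix_vector_mul_assoc matrix_vector_mul_lid
            transpose_mat)
      have "u\<^sub>X \<bullet> (pseudo_inverse V\<^sub>X *v u\<^sub>X) = u\<^sub>X \<bullet> (B *v (W *v (transpose B *v u\<^sub>X)))"
        by (simp only: assms(7) pseudo_inverse_congruence[OF AB BA VW] matrix_vector_mul_assoc matrix_mul_assoc)
      also have "\<dots> = u\<^sub>Y \<bullet> (W *v u\<^sub>Y)"
        by (simp only: inner_matrix_vector_mult_right[of u\<^sub>X B] BtAt)
      finally show ?thesis
        by (simp only: pseudo_inverse_invertible[OF VW])
    qed
    \<comment> \<open>Positivity of \<open>pseudo_det V\<^sub>X\<close> allows it to be cancelled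
      against the denominator in \<open>s\<close>.\<close>
    moreover have "sqrt (pseudo_det V\<^sub>Y) = s * sqrt (pseudo_det V\<^sub>X)"
      using pseudo_det_pos[of V\<^sub>X]
      by (simp add: assms(8) positive_definite_pseudo_det[OF assms(3)] flip: real_sqrt_mult)
    ultimately show ?thesis
      by (simp add: gaussian_density_def quadratic linear)
  qed
  ultimately show ?thesis
    by simp
qed

end
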